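(* Let $\mathcal{L}=\langle S, Act_\tau,\to\rangle$ be a finite-branching labelled transition system of processes. Suppose $\phi$ is a formula in $\mathrm{recHML}$ which is must-testable, i.e. there is a test $t$ (a closed term of the test language) such that for every $p\in S$, $p\ \mathbf{must\ satisfy}\ t$ if and only if $p\in[\![\phi]\!]$. Then there exists some $\psi\in\mathrm{mustHML}$ which is logically equivalent to $\phi$, i.e. $[\![\psi]\!]=[\![\phi]\!]$.
   Context: **Labelled transition systems.** An LTS over a countable set $Act$ of external actions is a triple $\langle S,Act_\tau,\to\rangle$ with $S$ a countable set of states (processes), $Act_\tau=Act\cup\{\tau\}$ where $\tau\notin Act$, and $\to\subseteq S\times Act_\tau\times S$; write $s\xrightarrow{\alpha}s'$ for $(s,\alpha,s')\in\to$, and $s\xrightarrow{\alpha}$ if such an $s'$ exists. The letter $a$ ranges over $Act$, $\alpha$ over $Act_\tau$. $\mathrm{Succ}(s)=\{s' : s\xrightarrow{\alpha}s'\text{ for some }\alpha\in Act_\tau\}$; the LTS is finite branching if $\mathrm{Succ}(s)$ is finite for all $s\in S$. $s\Uparrow$ (diverges) if there is an infinite path $s\xrightarrow{\tau}s_1\xrightarrow{\tau}\cdots$; otherwise $s\Downarrow$ (converges). Weak transitions: $\stackrel{\tau}{\Rightarrow}$ is the reflexive transitive closure of $\xrightarrow{\tau}$, and $s\stackrel{a}{\Rightarrow}s'$ means $s\stackrel{\tau}{\Rightarrow}s''\xrightarrow{a}s'''\stackrel{\tau}{\Rightarrow}s'$ for some $s'',s'''$; $s\stackrel{\alpha}{\Rightarrow}$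 means $s\stackrel{\alpha}{\Rightarrow}s'$ for some $s'$. **The languages recHML and mustHML.** $\mathrm{recHML}$ is the set of closed formulae generated by $\phi ::= \mathtt{tt}\mid\mathtt{ff}\mid X\mid \mathrm{Acc}\,A\mid\phi_1\vee\phi_2\mid\phi_1\wedge\phi_2\mid\langle\alpha\rangle\phi\mid[\alpha]\phi\mid\min(X,\phi)\mid\max(X,\phi)$, where $X$ ranges over a countable set $Var$ of variables, $\alpha\in Act_\tau$, $A$ is a finite subset of $Act$, and $\min(X,\cdot)$, $\max(X,\cdot)$ bind $X$. $\mathrm{mustHML}$ is the set of closed formulae generated by the fragment $\phi ::= \mathtt{tt}\mid\mathtt{ff}\mid \mathrm{Acc}\,A\mid X\mid[\alpha]\phi\mid\phi_1\wedge\phi_2\mid \min(X,\phi)$. Given an environment $\rho:Var\to 2^S$: $[\![\mathtt{tt}]\!]\rho=S$; $[\![\mathtt{ff}]\!]\rho=\emptyset$; $[\![X]\!]\rho=\rho(X)$; $[\![\mathrm{Acc}\,A]\!]\rho=\{s : s\Downarrow,\text{ and } s\stackrel{\tau}{\Rightarrow}s'\text{ implies } s'\stackrel{a}{\Rightarrow}\text{ for some }a\in A\}$; $[\![\langle\alpha\rangle\phi]\!]\rho=\{s : s\stackrel{\alpha}{\Rightarrow}s'\text{ for some }s'\in[\![\phi]\!]\rho\}$; $[\![[\alpha]\phi]\!]\rho=\{s : s\Downarrow,\text{ and } s\stackrel{\alpha}{\Rightarrow}s'\text{ implies }s'\in[\![\phi]\!]\rho\}$; $\vee,\wedge$ are union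 and intersection; $[\![\min(X,\phi)]\!]\rho=\bigcap\{P\subseteq S : [\![\phi]\!]\rho[X\mapsto P]\subseteq P\}$; $[\![\max(X,\phi)]\!]\rho=\bigcup\{P\subseteq S : P\subseteq[\![\phi]\!]\rho[X\mapsto P]\}$. For closed $\phi$ the environment is omitted. **Tests.** Let $\omega\notin Act_\tau$. Tests are the closed terms of $t::=0\mid\alpha.t\mid\omega.0\mid X\mid t_1+t_2\mid\mu X.t$ ($\alpha\in Act_\tau$, $\mu X$ binds $X$), with transitions given by the rules: $\alpha.t\xrightarrow{\alpha}t$ for $\alpha\in Act_\tau\cup\{\omega\}$; if $t_i\xrightarrow{\alpha}t'$ for $i=1$ or $i=2$ then $t_1+t_2\xrightarrow{\alpha}t'$; $\mu X.t\xrightarrow{\tau}t\{\mu X.t/X\}$. **Testing.** For a process $p$ and test $t$, the experiment $p\,|\,t$ has only $\tau$-moves: $p|t\to p'|t$ if $p\xrightarrow{\tau}p'$; $p|t\to p|t'$ if $t\xrightarrow{\tau}t'$; $p|t\to p'|t'$ if $p\xrightarrow{a}p'$ and $t\xrightarrow{a}t'$ for some $a\in Act$. A computation of $p|t$ is a maximal (finite or infinite) path $p|t\to p_1|t_1\to\cdots$ (with $p_0=p$, $t_0=t$); it is successful if $t_n\xrightarrow{\omega}$ for some $n\ge0$. $p\ \mathbf{must\ satisfy}\ t$ if every computation of $p|t$ is successful. *)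

theory Defs
  imports "HOL-Library.Countable_Set" "HOL-Library.FSet" "HOL-Library.Extended_Nat"
begin

section \<open>Labelled transition systems\<close>

text \<open>
  The set of external actions and the set of states are explicit carrier sets, so that both
  may be empty. \<open>Tau\<close> lies outside the external actions by construction.
\<close>

datatype 'a act = Tau | Vis 'a

definition act_tau :: "'a set \<Rightarrow> 'a act set" where
  "act_tau Act = insert Tau (Vis ` Act)"

type_synonym ('s, 'a) trans = "('s \<times> 'a act \<times> 's) set"

definition lts :: "'a set \<Rightarrow> 's set \<Rightarrow> ('s, 'a) trans \<Rightarrow> bool" where
  "lts Act S T \<longleftrightarrow> countable Act \<and> countable S \<and> T \<subseteq> S \<times> act_tau Act \<times> S"

definition Succ :: "('s, 'a) trans \<Rightarrow> 's \<Rightarrow> 's set" where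
  "Succ T s = {s'. \<exists>\<alpha>. (s, \<alpha>, s') \<in> T}"

definition finite_branching :: "'s set \<Rightarrow> ('s, 'a) trans \<Rightarrow> bool" where
  "finite_branching S T \<longleftrightarrow> (\<forall>s\<in>S. finite (Succ T s))"

definition diverges :: "('s, 'a) trans \<Rightarrow> 's \<Rightarrow> bool" where
  "diverges T s \<longleftrightarrow> (\<exists>f :: nat \<Rightarrow> 's. f 0 = s \<and> (\<forall>n. (f n, Tau, f (Suc n)) \<in> T))"

abbreviation converges :: "('s, 'a) trans \<Rightarrow> 's \<Rightarrow> bool" where
  "converges T s \<equiv> \<not> diverges T s"

definition tau_star :: "('s, 'a) trans \<Rightarrow> ('s \<times> 's) set" where
  "tau_star T = {(s, s'). (s, Tau, s') \<in> T}\<^sup>*"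

primrec weak :: "('s, 'a) trans \<Rightarrow> 'a act \<Rightarrow> 's \<Rightarrow> 's \<Rightarrow> bool" where
  "weak T Tau s s' \<longleftrightarrow> (s, s') \<in> tau_star T"
| "weak T (Vis a) s s' \<longleftrightarrow>
     (\<exists>u v. (s, u) \<in> tau_star T \<and> (u, Vis a, v) \<in> T \<and> (v, s') \<in> tau_star T)"


section \<open>The languages recHML and mustHML\<close>

text \<open>
  Variables are natural numbers, i.e. there is a countably infinite supply of them. The
  finiteness of the set \<open>A\<close> in \<open>Acc A\<close> is enforced by the type \<open>fset\<close>. The function
  \<open>form_actions\<close> returns the external actions occurring in a formula, both in modalities
  and in sets \<open>A\<close>.
\<close>

type_synonym var = nat

datatype (form_actions: 'a) form =
    TT
  | FF
  | FVar var
  | Acc "'a fset"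
  | Disj "'a form" "'a form"
  | Conj "'a form" "'a form"
  | Dia "'a act" "'a form"
  | Box "'a act" "'a form"
  | MinF var "'a form"
  | MaxF var "'a form"

primrec form_fv :: "'a form \<Rightarrow> var set" where
  "form_fv TT = {}"
| "form_fv FF = {}"
| "form_fv (FVar X) = {X}"
| "form_fv (Acc A) = {}"
| "form_fv (Disj \<phi> \<psi>) = form_fv \<phi> \<union> form_fv \<psi>"
| "form_fv (Conj \<phi> \<psi>) = form_fv \<phi> \<union> form_fv \<psi>"
| "form_fv (Dia \<alpha> \<phi>) = form_fv \<phi>"
| "form_fv (Box \<alpha> \<phi>) = form_fv \<phi>"
| "form_fv (MinF X \<phi>) = form_fv \<phi> - {X}"
| "form_fv (MaxF X \<phi>) = form_fv \<phi> - {X}"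

primrec must_fragment :: "'a form \<Rightarrow> bool" where
  "must_fragment TT \<longleftrightarrow> True"
| "must_fragment FF \<longleftrightarrow> True"
| "must_fragment (FVar X) \<longleftrightarrow> True"
| "must_fragment (Acc A) \<longleftrightarrow> True"
| "must_fragment (Disj \<phi> \<psi>) \<longleftrightarrow> False"
| "must_fragment (Conj \<phi> \<psi>) \<longleftrightarrow> must_fragment \<phi> \<and> must_fragment \<psi>"
| "must_fragment (Dia \<alpha> \<phi>) \<longleftrightarrow> False"
| "must_fragment (Box \<alpha> \<phi>) \<longleftrightarrow> must_fragment \<phi>"
| "must_fragment (MinF X \<phi>) \<longleftrightarrow> must_fragment \<phi>"
| "must_fragment (MaxF X \<phi>) \<longleftrightarrow> False"

definition recHML :: "'a set \<Rightarrow> 'a form set" where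
  "recHML Act = {\<phi>. form_actions \<phi> \<subseteq> Act \<and> form_fv \<phi> = {}}"

definition mustHML :: "'a set \<Rightarrow> 'a form set" where
  "mustHML Act = {\<phi> \<in> recHML Act. must_fragment \<phi>}"

text \<open>Only environments \<open>\<rho>\<close> with values in \<open>Pow S\<close> are meaningful below.\<close>

primrec sem :: "'s set \<Rightarrow> ('s, 'a) trans \<Rightarrow> 'a form \<Rightarrow> (var \<Rightarrow> 's set) \<Rightarrow> 's set" where
  "sem S T TT \<rho> = S"
| "sem S T FF \<rho> = {}"
| "sem S T (FVar X) \<rho> = \<rho> X"
| "sem S T (Acc A) \<rho> =
     {s \<in> S. converges T s \<and> (\<forall>s'. weak T Tau s s' \<longrightarrow> (\<exists>a u. a |\<in>| A \<and> weak T (Vis a) s' u))}"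
| "sem S T (Disj \<phi> \<psi>) \<rho> = sem S T \<phi> \<rho> \<union> sem S T \<psi> \<rho>"
| "sem S T (Conj \<phi> \<psi>) \<rho> = sem S T \<phi> \<rho> \<inter> sem S T \<psi> \<rho>"
| "sem S T (Dia \<alpha> \<phi>) \<rho> = {s \<in> S. \<exists>s'. weak T \<alpha> s s' \<and> s' \<in> sem S T \<phi> \<rho>}"
| "sem S T (Box \<alpha> \<phi>) \<rho> =
     {s \<in> S. converges T s \<and> (\<forall>s'. weak T \<alpha> s s' \<longrightarrow> s' \<in> sem S T \<phi> \<rho>)}"
| "sem S T (MinF X \<phi>) \<rho> = \<Inter> {P. P \<subseteq> S \<and> sem S T \<phi> (\<rho>(X := P)) \<subseteq> P}"
| "sem S T (MaxF X \<phi>) \<rho> = \<Union> {P. P \<subseteq> S \<and> P \<subseteq> sem S T \<phi> (\<rho>(X := P))}"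

lemma sem_cong:
  "(\<And>X. X \<in> form_fv \<phi> \<Longrightarrow> \<rho> X = \<rho>' X) \<Longrightarrow> sem S T \<phi> \<rho> = sem S T \<phi> \<rho>'"
proof (induction \<phi> arbitrary: \<rho> \<rho>')
  case (MinF X \<phi>)
  have "sem S T \<phi> (\<rho>(X := P)) = sem S T \<phi> (\<rho>'(X := P))" for P
    by (rule MinF.IH) (use MinF.prems in auto)
  then show ?case by simp
next
  case (MaxF X \<phi>)
  have "sem S T \<phi> (\<rho>(X := P)) = sem S T \<phi> (\<rho>'(X := P))" for P
    by (rule MaxF.IH) (use MaxF.prems in auto)
  then show ?case by simp
next
  case (Disj \<phi> \<psi>)
  have "sem S T \<phi> \<rho> = sem S T \<phi> \<rho>'" "sem S T \<psi> \<rho> = sem S T \<psi> \<rho>'"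
    using Disj.IH[of \<rho> \<rho>'] Disj.prems by auto
  then show ?case by simp
next
  case (Conj \<phi> \<psi>)
  have "sem S T \<phi> \<rho> = sem S T \<phi> \<rho>'" "sem S T \<psi> \<rho> = sem S T \<psi> \<rho>'"
    using Conj.IH[of \<rho> \<rho>'] Conj.prems by auto
  then show ?case by simp
next
  case (Dia \<alpha> \<phi>)
  have "sem S T \<phi> \<rho> = sem S T \<phi> \<rho>'"
    by (rule Dia.IH) (use Dia.prems in auto)
  then show ?case by simp
next
  case (Box \<alpha> \<phi>)
  have "sem S T \<phi> \<rho> = sem S T \<phi> \<rho>'"
    by (rule Box.IH) (use Box.prems in auto)
  then show ?case by simp
qed auto

text \<open>
  By \<open>sem_cong\<close> the semantics of a closed formula does not depend on the environment;
  the empty environment serves as the representative.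
\<close>

definition csem :: "'s set \<Rightarrow> ('s, 'a) trans \<Rightarrow> 'a form \<Rightarrow> 's set" where
  "csem S T \<phi> = sem S T \<phi> (\<lambda>_. {})"


section \<open>Tests\<close>

text \<open>
  \<open>Success\<close> stands for the term \<open>\<omega>.0\<close>, the only one in which \<open>\<omega>\<close> occurs.
\<close>

datatype (test_actions: 'a) test =
    Stop
  | Prefix "'a act" "'a test"
  | Success
  | TVar var
  | Choice "'a test" "'a test"
  | Mu var "'a test"

primrec test_fv :: "'a test \<Rightarrow> var set" where
  "test_fv Stop = {}"
| "test_fv (Prefix \<alpha> t) = test_fv t"
| "test_fv Success = {}"
| "test_fv (TVar X) = {X}"
| "test_fv (Choice t1 t2) = test_fv t1 \<union> test_fv t2"
| "test_fv (Mu X t) = test_fv t - {X}"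

definition tests :: "'a set \<Rightarrow> 'a test set" where
  "tests Act = {t. test_actions t \<subseteq> Act \<and> test_fv t = {}}"

text \<open>
  \<open>test_subst u X t\<close> is \<open>t{u/X}\<close>. No renaming of bound variables is needed, since along the
  transitions of closed terms only closed terms \<open>u\<close> are ever substituted.
\<close>

primrec test_subst :: "'a test \<Rightarrow> var \<Rightarrow> 'a test \<Rightarrow> 'a test" where
  "test_subst u X Stop = Stop"
| "test_subst u X (Prefix \<alpha> t) = Prefix \<alpha> (test_subst u X t)"
| "test_subst u X Success = Success"
| "test_subst u X (TVar Y) = (if Y = X then u else TVar Y)"
| "test_subst u X (Choice t1 t2) = Choice (test_subst u X t1) (test_subst u X t2)"
| "test_subst u X (Mu Y t) = (if Y = X then Mu Y t else Mu Y (test_subst u X t))"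

datatype 'a test_label = Omega | Lab "'a act"

inductive test_step :: "'a test \<Rightarrow> 'a test_label \<Rightarrow> 'a test \<Rightarrow> bool" where
  prefix: "test_step (Prefix \<alpha> t) (Lab \<alpha>) t"
| success: "test_step Success Omega Stop"
| choice1: "test_step t1 l t' \<Longrightarrow> test_step (Choice t1 t2) l t'"
| choice2: "test_step t2 l t' \<Longrightarrow> test_step (Choice t1 t2) l t'"
| mu: "test_step (Mu X t) (Lab Tau) (test_subst (Mu X t) X t)"


section \<open>Testing\<close>

inductive exp_step :: "('s, 'a) trans \<Rightarrow> 's \<times> 'a test \<Rightarrow> 's \<times> 'a test \<Rightarrow> bool"
  for T :: "('s, 'a) trans" where
  left: "(p, Tau, p') \<in> T \<Longrightarrow> exp_step T (p, t) (p', t)"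
| right: "test_step t (Lab Tau) t' \<Longrightarrow> exp_step T (p, t) (p, t')"
| comm: "(p, Vis a, p') \<in> T \<Longrightarrow> test_step t (Lab (Vis a)) t' \<Longrightarrow> exp_step T (p, t) (p', t')"

text \<open>
  A finite or infinite path is given by a sequence \<open>c\<close> and a number \<open>N\<close> of steps, which may
  be \<open>\<infinity>\<close>; the values of \<open>c\<close> beyond index \<open>N\<close> are irrelevant.
\<close>

definition computation ::
  "('s, 'a) trans \<Rightarrow> 's \<Rightarrow> 'a test \<Rightarrow> (nat \<Rightarrow> 's \<times> 'a test) \<Rightarrow> enat \<Rightarrow> bool" where
  "computation T p t c N \<longleftrightarrow>
     c 0 = (p, t) \<and>
     (\<forall>i. enat i < N \<longrightarrow> exp_step T (c i) (c (Suc i))) \<and>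
     (\<forall>n. N = enat n \<longrightarrow> (\<nexists>e. exp_step T (c n) e))"

definition successful :: "(nat \<Rightarrow> 's \<times> 'a test) \<Rightarrow> enat \<Rightarrow> bool" where
  "successful c N \<longleftrightarrow> (\<exists>n. enat n \<le> N \<and> (\<exists>t'. test_step (snd (c n)) Omega t'))"

definition must_satisfy :: "('s, 'a) trans \<Rightarrow> 's \<Rightarrow> 'a test \<Rightarrow> bool" where
  "must_satisfy T p t \<longleftrightarrow> (\<forall>c N. computation T p t c N \<longrightarrow> successful c N)"

definition must_testable :: "'a set \<Rightarrow> 's set \<Rightarrow> ('s, 'a) trans \<Rightarrow> 'a form \<Rightarrow> bool" where
  "must_testable Act S T \<phi> \<longleftrightarrow>
     (\<exists>t \<in> tests Act. \<forall>p \<in> S. must_satisfy T p t \<longleftrightarrow> p \<in> csem S T \<phi>)"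

end

theory Submission
  imports Defs
begin

text \<open>
  Only the test matters: every test \<open>t\<close> has a characteristic formula in mustHML, satisfied by
  exactly the processes that must satisfy \<open>t\<close>. Passing a test is a least fixpoint over the
  experiment steps: \<open>p | t\<close> passes if \<open>t\<close> can succeed at once, or if it is not deadlocked and all
  its successors pass. If \<open>t\<close> cannot succeed at once, this can be expressed by the
  conjunction of \<open>[\<alpha>]\<chi>\<close> over all moves \<open>\<alpha>\<close> of \<open>t\<close>, where \<open>\<chi>\<close> describes the residual test,
  together with \<open>Acc A\<close> for the set \<open>A\<close> of initial actions of \<open>t\<close> in case \<open>t\<close> has no
  \<open>\<tau>\<close>-move. Recursion in tests turns into \<open>min\<close>.
\<close>

section \<open>Passing a test as a least fixpoint\<close>

abbreviation can_succeed :: "'a test \<Rightarrow> bool" where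
  "can_succeed t \<equiv> \<exists>t'. test_step t Omega t'"

text \<open>Being least, the predicate admits no infinite run without success; the witness
  \<open>d\<close> in \<open>later\<close> rules out deadlock.\<close>

inductive passes :: "('s, 'a) trans \<Rightarrow> 's \<times> 'a test \<Rightarrow> bool" for T where
  now: "can_succeed (snd e) \<Longrightarrow> passes T e"
| later: "exp_step T e d \<Longrightarrow> (\<And>e'. exp_step T e e' \<Longrightarrow> passes T e') \<Longrightarrow> passes T e"

lemma passes_can_succeed: "can_succeed t \<Longrightarrow> passes T (p, t)"
  by (rule passes.now) simp

lemma passes_step:
  "passes T e \<Longrightarrow> \<not> can_succeed (snd e) \<Longrightarrow> exp_step T e e' \<Longrightarrow> passes T e'"
  by (erule passes.cases) auto

text \<open>Induction on passing, for an arbitrary position \<open>i\<close>: in the case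
  \<open>later\<close> there is no deadlock, so a maximal path cannot end at \<open>i\<close> and
  continues to \<open>Suc i\<close>.\<close>

lemma passes_imp_successful:
  assumes "passes T e" "computation T p t c N" "c i = e" "enat i \<le> N"
  shows "successful c N"
  using assms
proof (induction arbitrary: i rule: passes.induct)
  case (now e)
  then show ?case unfolding successful_def by auto
next
  case (later e d)
  have "enat i \<noteq> N"
    using later.hyps(1) later.prems unfolding computation_def by blast
  then have "enat i < N" using later.prems by simp
  then have "exp_step T e (c (Suc i))" "enat (Suc i) \<le> N"
    using later.prems by (auto simp: computation_def Suc_ile_eq)
  then show ?case using later.IH later.prems(1) by blast
qed

text \<open>A failing experiment that is not deadlocked has a failing successor. Choosing such
  successors repeatedly gives a computation that is infinite or ends in a deadlock.\<close>

lemma not_passes_imp_unsuccessful: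
  assumes "\<not> passes T (p, t)"
  shows "\<exists>c N. computation T p t c N \<and> \<not> successful c N"
proof -
  define nxt where "nxt e = (SOME e'. exp_step T e e' \<and> \<not> passes T e')" for e
  define c where "c n = (nxt ^^ n) (p, t)" for n
  define dead where "dead n \<longleftrightarrow> (\<nexists>e. exp_step T (c n) e)" for n
  have nxt: "exp_step T e (nxt e) \<and> \<not> passes T (nxt e)"
    if "\<not> passes T e" "exp_step T e d" for e d
  proof -
    have "\<exists>e'. exp_step T e e' \<and> \<not> passes T e'" using that passes.later by metis
    then show ?thesis unfolding nxt_def by (rule someI_ex)
  qed
  have c: "\<not> passes T (c n)" if "\<And>i. i < n \<Longrightarrow> \<not> dead i" for n
    using that
  proof (induction n)
    case 0
    then show ?case using assms by (simp add: c_def)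
  next
    case (Suc n)
    then have "\<not> passes T (c n)" "\<not> dead n" by auto
    then show ?case using nxt unfolding dead_def c_def by fastforce
  qed
  have step: "exp_step T (c n) (c (Suc n))" if "\<And>i. i \<le> n \<Longrightarrow> \<not> dead i" for n
  proof -
    have "\<not> passes T (c n)" "\<not> dead n" using that c by auto
    then show ?thesis using nxt unfolding dead_def c_def by fastforce
  qed
  have fail: "\<not> can_succeed (snd (c n))" if "\<And>i. i < n \<Longrightarrow> \<not> dead i" for n
    using c[OF that] passes.now by blast
  show ?thesis
  proof (cases "\<exists>n. dead n")
    case True
    \<comment> \<open>Past the first deadlock the values of \<open>nxt\<close> are arbitrary, so the
      path is cut off there.\<close>
    define k where "k = (LEAST n. dead n)"
    have k: "dead k" "\<And>i. i < k \<Longrightarrow> \<not> dead i"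
      unfolding k_def using True LeastI_ex not_less_Least by metis+
    have "computation T p t c (enat k)"
      unfolding computation_def using k step by (auto simp: c_def dead_def)
    moreover have "\<not> successful c (enat k)"
      unfolding successful_def using k fail by auto
    ultimately show ?thesis by blast
  next
    case False
    then have "computation T p t c \<infinity>" "\<not> successful c \<infinity>"
      unfolding computation_def successful_def using step fail by (auto simp: c_def)
    then show ?thesis by blast
  qed
qed

lemma must_satisfy_iff_passes: "must_satisfy T p t \<longleftrightarrow> passes T (p, t)"
proof
  show "must_satisfy T p t \<Longrightarrow> passes T (p, t)"
    using not_passes_imp_unsuccessful unfolding must_satisfy_def by metis
  assume "passes T (p, t)"
  then show "must_satisfy T p t"
    unfolding must_satisfy_def
    using passes_imp_successful[where i = 0] by (force simp: computation_def zero_enat_def[symmetric])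
qed

text \<open>Passing is inherited along steps taken before success; once the test can succeed, later
  experiments may fail.\<close>

definition pending_step :: "('s, 'a) trans \<Rightarrow> 's \<times> 'a test \<Rightarrow> 's \<times> 'a test \<Rightarrow> bool" where
  "pending_step T e e' \<longleftrightarrow> \<not> can_succeed (snd e) \<and> exp_step T e e'"

text \<open>The hypothesis covers all experiments reached in one or more pending steps. To obtain
  it, \<open>P\<close> is proved for everything reachable from \<open>e\<close> in zero or more such
  steps.\<close>

lemma passes_strong_induct [consumes 1, case_names less]:
  assumes "passes T e"
    and less: "\<And>e. passes T e \<Longrightarrow> (\<And>e'. (pending_step T)\<^sup>+\<^sup>+ e e' \<Longrightarrow> P e') \<Longrightarrow> P e"
  shows "P e"
proof -
  have "\<forall>e'. (pending_step T)\<^sup>*\<^sup>* e e' \<longrightarrow> P e'"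
    using assms(1)
  proof (induction rule: passes.induct)
    case (now e)
    have none: "\<not> pending_step T e d" for d using now by (simp add: pending_step_def)
    have "\<not> (pending_step T)\<^sup>+\<^sup>+ e d" for d
      using none by (auto dest: tranclpD)
    then have "P e" using less passes.now[OF now] by blast
    then show ?case using none by (metis converse_rtranclpE)
  next
    case (later e d)
    have tc: "P e'" if "(pending_step T)\<^sup>+\<^sup>+ e e'" for e'
      using tranclpD[OF that] later.IH unfolding pending_step_def[of T e] by blast
    have "passes T e" by (rule passes.later) (use later in auto)
    then have "P e" using less tc by blast
    then show ?case using tc by (metis rtranclpD)
  qed
  then show ?thesis by blast
qed

section \<open>Passing, convergence and weak transitions\<close>

text \<open>An infinite \<tau>-path \<open>f\<close> of the process with \<open>t\<close> idle would
  never succeed: induction on passing refutes that any \<open>(f n, t)\<close> passes.\<close>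

lemma passes_converges:
  assumes "passes T (p, t)" "\<not> can_succeed t"
  shows "converges T p"
proof
  assume "diverges T p"
  then obtain f where f: "f 0 = p" "\<And>n. (f n, Tau, f (Suc n)) \<in> T"
    unfolding diverges_def by blast
  have "\<And>n. f n = fst e \<Longrightarrow> snd e = t \<Longrightarrow> False" if "passes T e" for e
    using that
  proof (induction rule: passes.induct)
    case (now e)
    then show ?case using assms(2) by simp
  next
    case (later e d)
    have "exp_step T e (f (Suc n), t)"
      using exp_step.left[OF f(2)[of n]] later.prems by (metis prod.collapse)
    then show ?case using later.IH[of "(f (Suc n), t)" "Suc n"] by simp
  qed
  from this[OF assms(1)] f(1) show False by fastforce
qed

lemma passes_tau_star:
  assumes "(p, p') \<in> tau_star T" "passes T (p, t)" "\<not> can_succeed t"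
  shows "passes T (p', t)"
  using assms unfolding tau_star_def
  by (induction rule: rtrancl_induct) (auto intro: passes_step exp_step.left)

lemma weak_tau_step:
  "(p, Tau, p') \<in> T \<Longrightarrow> weak T \<alpha> p' u \<Longrightarrow> weak T \<alpha> p u"
  by (cases \<alpha>) (auto simp: tau_star_def intro: converse_rtrancl_into_rtrancl)

lemma converges_tau_step:
  assumes "(p, Tau, p') \<in> T" "converges T p"
  shows "converges T p'"
proof
  assume "diverges T p'"
  then obtain f where f: "f 0 = p'" "\<And>n. (f n, Tau, f (Suc n)) \<in> T"
    unfolding diverges_def by blast
  have "diverges T p"
    unfolding diverges_def
    by (rule exI[of _ "case_nat p f"]) (use f assms(1) in \<open>auto split: nat.split\<close>)
  then show False using assms(2) by simp
qed

text \<open>Weak transitions absorb a leading \<tau>, and \<tau>-successors inherit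
  convergence.\<close>

lemma sem_Box_tau_step:
  "p \<in> sem S T (Box \<alpha> \<phi>) \<rho> \<Longrightarrow> (p, Tau, p') \<in> T \<Longrightarrow> p' \<in> S \<Longrightarrow> p' \<in> sem S T (Box \<alpha> \<phi>) \<rho>"
  by (simp add: converges_tau_step weak_tau_step[of p p' T \<alpha>])

lemma sem_Acc_tau_step:
  "p \<in> sem S T (Acc A) \<rho> \<Longrightarrow> (p, Tau, p') \<in> T \<Longrightarrow> p' \<in> S \<Longrightarrow> p' \<in> sem S T (Acc A) \<rho>"
  by (simp add: converges_tau_step weak_tau_step[of p p' T Tau] del: weak.simps)

text \<open>Induction on passing: since \<open>t\<close> cannot move alone, the available step is a
  communication or a \<tau>-move of the process, after which the induction hypothesis applies. This
  yields the \<open>Acc\<close> conjunct.\<close>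

lemma passes_weak_action:
  assumes "passes T (p, t)" "\<not> can_succeed t" "\<And>t'. \<not> test_step t (Lab Tau) t'"
  shows "\<exists>a t' u. test_step t (Lab (Vis a)) t' \<and> weak T (Vis a) p u"
  using assms(1)
proof (induction "(p, t)" arbitrary: p rule: passes.induct)
  case now
  then show ?case using assms(2) by simp
next
  case (later d p)
  from \<open>exp_step T (p, t) d\<close> show ?case
  proof cases
    case (left p')
    then show ?thesis using later.hyps by (meson exp_step.left weak_tau_step)
  next
    case (right t')
    then show ?thesis using assms(3) by blast
  next
    case (comm a p' t')
    then have "weak T (Vis a) p p'" by (auto simp: tau_star_def)
    then show ?thesis using comm by blast
  qed
qed


section \<open>Characteristic formulae\<close>

text \<open>Syntactic, hence usable on open tests: a variable stands for a recursive test, which can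
  only make a \<tau>-move.\<close>

primrec succeeds :: "'a test \<Rightarrow> bool" where
  "succeeds Stop \<longleftrightarrow> False"
| "succeeds (Prefix \<alpha> t) \<longleftrightarrow> False"
| "succeeds Success \<longleftrightarrow> True"
| "succeeds (TVar X) \<longleftrightarrow> False"
| "succeeds (Choice t1 t2) \<longleftrightarrow> succeeds t1 \<or> succeeds t2"
| "succeeds (Mu X t) \<longleftrightarrow> False"

primrec conj_list :: "'a form list \<Rightarrow> 'a form" where
  "conj_list [] = TT"
| "conj_list (\<phi> # \<phi>s) = Conj \<phi> (conj_list \<phi>s)"

text \<open>The flag \<open>b\<close> says whether the test succeeds at once. \<open>Acc\<close>
  guards against deadlock, which a \<tau>-move of the test already excludes. If \<open>b\<close> is
  false and \<open>L\<close> is empty, \<open>Acc {||}\<close> makes the formula unsatisfiable, as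
  is right for \<open>Stop\<close>.\<close>

definition moves_form :: "bool \<Rightarrow> ('a act \<times> 'a form) list \<Rightarrow> 'a form" where
  "moves_form b L =
     (if b then TT
      else conj_list ((if Tau \<in> fst ` set L then [] else [Acc (fset_of_list [a. (Vis a, _) \<leftarrow> L])])
        @ map (\<lambda>(\<alpha>, \<phi>). Box \<alpha> \<phi>) L))"

text \<open>
  A variable \<open>X\<close> of a test stands for the recursive test \<open>\<mu>X.t\<close>, whereas in the formulae \<open>X\<close>
  describes the unfolding of \<open>\<mu>X.t\<close>. As the \<open>\<tau>\<close>-move to that unfolding is the only move of
  \<open>\<mu>X.t\<close>, this makes unguarded variables under \<open>+\<close> unproblematic.
\<close>

primrec moves :: "'a test \<Rightarrow> ('a act \<times> 'a form) list" where
  "moves Stop = []"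
| "moves (Prefix \<alpha> t) = [(\<alpha>, moves_form (succeeds t) (moves t))]"
| "moves Success = []"
| "moves (TVar X) = [(Tau, FVar X)]"
| "moves (Choice t1 t2) = moves t1 @ moves t2"
| "moves (Mu X t) = [(Tau, MinF X (moves_form (succeeds t) (moves t)))]"

definition char_form :: "'a test \<Rightarrow> 'a form" where
  "char_form t = moves_form (succeeds t) (moves t)"

lemma moves_Prefix: "moves (Prefix \<alpha> t) = [(\<alpha>, char_form t)]"
  by (simp add: char_form_def)

lemma moves_Mu: "moves (Mu X t) = [(Tau, MinF X (char_form t))]"
  by (simp add: char_form_def)

section \<open>Characteristic formulae lie in mustHML\<close>

lemma form_fv_conj_list: "form_fv (conj_list \<phi>s) = \<Union> (form_fv ` set \<phi>s)"
  by (induction \<phi>s) auto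

lemma form_actions_conj_list: "form_actions (conj_list \<phi>s) = \<Union> (form_actions ` set \<phi>s)"
  by (induction \<phi>s) auto

lemma must_fragment_conj_list: "must_fragment (conj_list \<phi>s) \<longleftrightarrow> (\<forall>\<phi>\<in>set \<phi>s. must_fragment \<phi>)"
  by (induction \<phi>s) auto

lemma sem_conj_list:
  "p \<in> sem S T (conj_list \<phi>s) \<rho> \<longleftrightarrow> p \<in> S \<and> (\<forall>\<phi>\<in>set \<phi>s. p \<in> sem S T \<phi> \<rho>)"
  by (induction \<phi>s) auto

lemma fv_moves_form:
  assumes "\<And>\<alpha> \<phi>. (\<alpha>, \<phi>) \<in> set L \<Longrightarrow> form_fv \<phi> \<subseteq> V"
  shows "form_fv (moves_form b L) \<subseteq> V"
  by (auto simp: moves_form_def form_fv_conj_list dest!: assms)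

lemma actions_moves_form:
  assumes "\<And>\<alpha> \<phi>. (\<alpha>, \<phi>) \<in> set L \<Longrightarrow> set_act \<alpha> \<union> form_actions \<phi> \<subseteq> V"
  shows "form_actions (moves_form b L) \<subseteq> V"
proof -
  have "form_actions (Box \<alpha> \<phi>) \<subseteq> V" if "(\<alpha>, \<phi>) \<in> set L" for \<alpha> \<phi>
    using assms[OF that] by simp
  moreover have "a \<in> V" if "(Vis a, \<phi>) \<in> set L" for a \<phi>
    using assms[OF that] by simp
  then have "form_actions (Acc (fset_of_list [a. (Vis a, _) \<leftarrow> L])) \<subseteq> V"
    by (auto simp: fset_of_list.rep_eq split: act.splits)
  ultimately show ?thesis
    by (auto simp: moves_form_def form_actions_conj_list simp del: form.set(4,8))
qed

lemma must_fragment_moves_form: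
  "(\<And>\<alpha> \<phi>. (\<alpha>, \<phi>) \<in> set L \<Longrightarrow> must_fragment \<phi>) \<Longrightarrow> must_fragment (moves_form b L)"
  by (auto simp: moves_form_def must_fragment_conj_list)

lemma fv_moves: "(\<alpha>, \<phi>) \<in> set (moves t) \<Longrightarrow> form_fv \<phi> \<subseteq> test_fv t"
proof (induction t arbitrary: \<alpha> \<phi>)
  case (Prefix \<beta> t)
  have "form_fv (moves_form (succeeds t) (moves t)) \<subseteq> test_fv t"
    by (rule fv_moves_form) (rule Prefix.IH)
  then show ?case using Prefix.prems by simp
next
  case (Mu X t)
  have "form_fv (moves_form (succeeds t) (moves t)) \<subseteq> test_fv t"
    by (rule fv_moves_form) (rule Mu.IH)
  then show ?case using Mu.prems by auto
next
  case (Choice t1 t2)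
  then show ?case by (simp add: subset_iff) blast
qed auto

lemma actions_moves:
  "(\<alpha>, \<phi>) \<in> set (moves t) \<Longrightarrow> set_act \<alpha> \<union> form_actions \<phi> \<subseteq> test_actions t"
proof (induction t arbitrary: \<alpha> \<phi>)
  case (Prefix \<beta> t)
  have "form_actions (moves_form (succeeds t) (moves t)) \<subseteq> test_actions t"
    by (rule actions_moves_form) (rule Prefix.IH)
  then show ?case using Prefix.prems by auto
next
  case (Mu X t)
  have "form_actions (moves_form (succeeds t) (moves t)) \<subseteq> test_actions t"
    by (rule actions_moves_form) (rule Mu.IH)
  then show ?case using Mu.prems by auto
next
  case (Choice t1 t2)
  then show ?case by (simp add: subset_iff) blast
qed auto

lemma must_fragment_moves: "(\<alpha>, \<phi>) \<in> set (moves t) \<Longrightarrow> must_fragment \<phi>"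
  by (induction t arbitrary: \<alpha> \<phi>) (auto intro: must_fragment_moves_form)

lemma char_form_mustHML:
  assumes "t \<in> tests Act"
  shows "char_form t \<in> mustHML Act"
proof -
  have "form_fv (char_form t) \<subseteq> test_fv t"
    unfolding char_form_def by (rule fv_moves_form) (rule fv_moves)
  moreover have "form_actions (char_form t) \<subseteq> test_actions t"
    unfolding char_form_def by (rule actions_moves_form) (rule actions_moves)
  moreover have "must_fragment (char_form t)"
    unfolding char_form_def by (rule must_fragment_moves_form) (rule must_fragment_moves)
  ultimately show ?thesis
    using assms by (auto simp: mustHML_def recHML_def tests_def)
qed


section \<open>Closing substitutions\<close>

text \<open>Not capture-avoiding: it is applied with closed values, except that a bound variable is
  mapped to itself under its binder.\<close>

primrec inst :: "(var \<Rightarrow> 'a test) \<Rightarrow> 'a test \<Rightarrow> 'a test" where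
  "inst \<sigma> Stop = Stop"
| "inst \<sigma> (Prefix \<alpha> t) = Prefix \<alpha> (inst \<sigma> t)"
| "inst \<sigma> Success = Success"
| "inst \<sigma> (TVar X) = \<sigma> X"
| "inst \<sigma> (Choice t1 t2) = Choice (inst \<sigma> t1) (inst \<sigma> t2)"
| "inst \<sigma> (Mu X t) = Mu X (inst (\<sigma>(X := TVar X)) t)"

lemma inst_id: "(\<And>X. X \<in> test_fv t \<Longrightarrow> \<sigma> X = TVar X) \<Longrightarrow> inst \<sigma> t = t"
  by (induction t arbitrary: \<sigma>) auto

lemma fv_inst: "(\<And>Y. Y \<in> test_fv t \<Longrightarrow> test_fv (\<sigma> Y) \<subseteq> V) \<Longrightarrow> test_fv (inst \<sigma> t) \<subseteq> V"
proof (induction t arbitrary: \<sigma> V)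
  case (Mu X t)
  have "test_fv (inst (\<sigma>(X := TVar X)) t) \<subseteq> insert X V"
    by (rule Mu.IH) (use Mu.prems in auto)
  then show ?case by auto
qed auto

lemma test_subst_fresh: "X \<notin> test_fv t \<Longrightarrow> test_subst u X t = t"
  by (induction t) auto

text \<open>Absorbs the unfolding of a recursion into the substitution, so that structural induction
  on open tests stays possible. The first premise protects the values of the other
  variables.\<close>

lemma test_subst_inst:
  "(\<And>Y. Y \<noteq> X \<Longrightarrow> X \<notin> test_fv (\<sigma> Y)) \<Longrightarrow> \<sigma> X = TVar X \<Longrightarrow>
    test_subst u X (inst \<sigma> t) = inst (\<sigma>(X := u)) t"
proof (induction t arbitrary: \<sigma>)
  case (Mu Y t)
  show ?case
  proof (cases "Y = X")
    case True
    then show ?thesis by (simp del: fun_upd_apply)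
  next
    case False
    have "test_subst u X (inst (\<sigma>(Y := TVar Y)) t) = inst (\<sigma>(Y := TVar Y, X := u)) t"
      by (rule Mu.IH) (use Mu.prems False in auto)
    then show ?thesis using False fun_upd_twist[OF False, of \<sigma> "TVar Y" u]
      by (simp del: fun_upd_apply)
  qed
qed (auto simp: test_subst_fresh)

text \<open>\<open>U X\<close> is the unfolding of the recursive test \<open>\<sigma> X\<close>.\<close>

definition closing :: "(var \<Rightarrow> 'a test) \<Rightarrow> (var \<Rightarrow> 'a test) \<Rightarrow> bool" where
  "closing \<sigma> U \<longleftrightarrow>
     (\<forall>X. test_fv (\<sigma> X) = {} \<and> (\<forall>l t'. test_step (\<sigma> X) l t' \<longleftrightarrow> l = Lab Tau \<and> t' = U X))"

inductive_simps test_step_Stop [simp]: "test_step Stop l t'"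
inductive_simps test_step_Success [simp]: "test_step Success l t'"
inductive_simps test_step_Prefix [simp]: "test_step (Prefix \<alpha> t) l t'"
inductive_simps test_step_Choice [simp]: "test_step (Choice t1 t2) l t'"
inductive_simps test_step_Mu [simp]: "test_step (Mu X t) l t'"

lemma test_step_inst_Mu:
  assumes "closing \<sigma> U"
  shows "test_step (inst \<sigma> (Mu X t)) l t' \<longleftrightarrow>
    l = Lab Tau \<and> t' = inst (\<sigma>(X := inst \<sigma> (Mu X t))) t"
proof -
  have "test_subst u X (inst (\<sigma>(X := TVar X)) t) = inst (\<sigma>(X := u)) t" for u
    using test_subst_inst[of X "\<sigma>(X := TVar X)" u t] assms by (simp add: closing_def)
  then show ?thesis by auto
qed

lemma closing_Mu:
  assumes "closing \<sigma> U"
  shows "closing (\<sigma>(X := inst \<sigma> (Mu X t))) (U(X := inst (\<sigma>(X := inst \<sigma> (Mu X t))) t))"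
proof -
  have "test_fv (inst \<sigma> (Mu X t)) \<subseteq> {}"
    by (rule fv_inst) (use assms in \<open>auto simp: closing_def\<close>)
  then show ?thesis
    using assms test_step_inst_Mu[OF assms, of X t] unfolding closing_def by simp
qed

lemma succeeds_inst: "closing \<sigma> U \<Longrightarrow> can_succeed (inst \<sigma> t) \<longleftrightarrow> succeeds t"
  by (induction t) (auto simp: closing_def)

text \<open>A starting point for closed tests, which the substitution leaves unchanged. No process
  passes \<open>Stop\<close>, in agreement with the empty environment.\<close>

lemma closing_Mu_Stop: "closing (\<lambda>X. Mu X Stop) (\<lambda>X. Stop)"
  by (auto simp: closing_def)

lemma inst_closed: "test_fv t = {} \<Longrightarrow> inst \<sigma> t = t"
  by (rule inst_id) simp


section \<open>Characteristic formulae are sound and complete\<close>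

definition pass_set :: "'s set \<Rightarrow> ('s, 'a) trans \<Rightarrow> 'a test \<Rightarrow> 's set" where
  "pass_set S T t = {p \<in> S. passes T (p, t)}"

section \<open>Soundness: satisfying the formula implies passing\<close>

text \<open>The processes satisfying the formula are closed under \<tau>-moves. A failing one would
  have a failing \<tau>-successor, and so on forever, against the convergence built into
  \<open>Box\<close> and \<open>Acc\<close>.\<close>

lemma moves_form_sound:
  assumes T: "T \<subseteq> S \<times> UNIV \<times> S"
    and b: "b \<longleftrightarrow> can_succeed u"
    and steps: "\<And>\<alpha> t'. test_step u (Lab \<alpha>) t' \<Longrightarrow>
      \<exists>\<phi>. (\<alpha>, \<phi>) \<in> set L \<and> sem S T \<phi> \<rho> \<subseteq> pass_set S T t'"
    and enabled: "\<And>\<alpha> \<phi>. (\<alpha>, \<phi>) \<in> set L \<Longrightarrow> \<exists>t'. test_step u (Lab \<alpha>) t'"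
  shows "sem S T (moves_form b L) \<rho> \<subseteq> pass_set S T u"
proof (cases b)
  case True
  then show ?thesis
    using b by (auto simp: moves_form_def pass_set_def intro: passes_can_succeed)
next
  case False
  let ?F = "sem S T (moves_form b L) \<rho>"
  have mem: "p \<in> ?F \<longleftrightarrow> p \<in> S \<and>
      (Tau \<notin> fst ` set L \<longrightarrow> p \<in> sem S T (Acc (fset_of_list [a. (Vis a, _) \<leftarrow> L])) \<rho>) \<and>
      (\<forall>(\<alpha>, \<phi>)\<in>set L. p \<in> sem S T (Box \<alpha> \<phi>) \<rho>)" for p
    using False by (auto simp: moves_form_def sem_conj_list)
  have conv: "converges T p" if "p \<in> ?F" for p
    using that unfolding mem by (cases "Tau \<in> fst ` set L") auto
  have closed: "p' \<in> ?F" if "p \<in> ?F" "(p, Tau, p') \<in> T" for p p'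
  proof -
    have "p' \<in> S" using that T by blast
    then show ?thesis
      using that sem_Box_tau_step[OF _ that(2)] sem_Acc_tau_step[OF _ that(2)] unfolding mem by blast
  qed
  \<comment> \<open>Some step exists, by a \<tau>-move of the test or by \<open>Acc\<close>. Steps
    in which the test moves reach residuals that pass by \<open>steps\<close>, so failure can only
    continue through a \<tau>-move of the process.\<close>
  have left: "\<exists>p'. (p, Tau, p') \<in> T \<and> \<not> passes T (p', u)" if p: "p \<in> ?F" "\<not> passes T (p, u)" for p
  proof -
    have "\<exists>d. exp_step T (p, u) d"
    proof (cases "Tau \<in> fst ` set L")
      case True
      then show ?thesis using enabled exp_step.right by fastforce
    next
      case no_tau: False
      have "p \<in> sem S T (Acc (fset_of_list [a. (Vis a, _) \<leftarrow> L])) \<rho>"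
        using p(1) no_tau unfolding mem by blast
      then obtain a s where a: "a |\<in>| fset_of_list [a. (Vis a, _) \<leftarrow> L]" and s: "weak T (Vis a) p s"
        by (fastforce simp: tau_star_def simp del: weak.simps(2))
      from a obtain \<phi> where "(Vis a, \<phi>) \<in> set L"
        by (auto simp: fset_of_list_elem split: act.splits)
      then obtain t' where t': "test_step u (Lab (Vis a)) t'" using enabled by blast
      \<comment> \<open>\<open>Acc\<close> promises only a weak action: either it synchronises with
        the test at once, or the process has a first \<tau>-move.\<close>
      from s obtain q r where q: "(p, q) \<in> {(s, s'). (s, Tau, s') \<in> T}\<^sup>*" "(q, Vis a, r) \<in> T"
        by (auto simp: tau_star_def)
      from q(1) show ?thesis
      proof (cases rule: converse_rtranclE)
        case base
        then show ?thesis using q(2) t' exp_step.comm by fast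
      next
        case (step p')
        then show ?thesis using exp_step.left by fast
      qed
    qed
    then obtain d where d: "exp_step T (p, u) d" "\<not> passes T d"
      using p(2) passes.later by metis
    from d(1) show ?thesis
    proof cases
      case (left p')
      then show ?thesis using d by blast
    next
      case (right t')
      then obtain \<phi> where \<phi>: "(Tau, \<phi>) \<in> set L" "sem S T \<phi> \<rho> \<subseteq> pass_set S T t'"
        using steps by blast
      have "p \<in> sem S T \<phi> \<rho>" using p(1) \<phi>(1) unfolding mem by (force simp: tau_star_def)
      then show ?thesis using d(2) right \<phi>(2) by (auto simp: pass_set_def)
    next
      case (comm a p' t')
      then obtain \<phi> where \<phi>: "(Vis a, \<phi>) \<in> set L" "sem S T \<phi> \<rho> \<subseteq> pass_set S T t'"
        using steps by blast
      have "weak T (Vis a) p p'" using comm by (auto simp: tau_star_def)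
      then have "p' \<in> sem S T \<phi> \<rho>" using p(1) \<phi>(1) unfolding mem by fastforce
      then show ?thesis using d(2) comm \<phi>(2) by (auto simp: pass_set_def)
    qed
  qed
  show ?thesis
  proof
    fix p assume p: "p \<in> ?F"
    have "passes T (p, u)"
    proof (rule ccontr)
      assume np: "\<not> passes T (p, u)"
      have "\<exists>f. \<forall>n. (f n \<in> ?F \<and> \<not> passes T (f n, u) \<and> (n = 0 \<longrightarrow> f n = p))
          \<and> (f n, Tau, f (Suc n)) \<in> T"
        by (rule dependent_nat_choice) (use p np left closed in blast)+
      then have "diverges T p" unfolding diverges_def by blast
      then show False using conv[OF p] by simp
    qed
    then show "p \<in> pass_set S T u" using p mem by (simp add: pass_set_def)
  qed
qed

lemma moves_inst_enabled:
  assumes "closing \<sigma> U" "(\<alpha>, \<phi>) \<in> set (moves t)"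
  shows "\<exists>t'. test_step (inst \<sigma> t) (Lab \<alpha>) t'"
  using assms(2)
proof (induction t)
  case (TVar X)
  then show ?case using assms(1) by (simp add: closing_def)
next
  case (Choice t1 t2)
  then show ?case by (metis Un_iff inst.simps(5) moves.simps(5) set_append test_step_Choice)
qed auto

text \<open>Structural induction on open tests; the environment bounds each variable by the
  processes passing the corresponding unfolding.\<close>

lemma moves_sound:
  assumes "T \<subseteq> S \<times> UNIV \<times> S" "closing \<sigma> U" "\<And>X. \<rho> X \<subseteq> pass_set S T (U X)"
    and "test_step (inst \<sigma> t) (Lab \<alpha>) t'"
  shows "\<exists>\<phi>. (\<alpha>, \<phi>) \<in> set (moves t) \<and> sem S T \<phi> \<rho> \<subseteq> pass_set S T t'"
  using assms
proof (induction t arbitrary: \<sigma> U \<rho> \<alpha> t')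
  case (Prefix \<beta> t)
  have "sem S T (char_form t) \<rho> \<subseteq> pass_set S T (inst \<sigma> t)"
    unfolding char_form_def
  proof (rule moves_form_sound)
    show "T \<subseteq> S \<times> UNIV \<times> S" by fact
    show "succeeds t \<longleftrightarrow> can_succeed (inst \<sigma> t)"
      using succeeds_inst Prefix.prems by blast
    show "\<exists>t'. test_step (inst \<sigma> t) (Lab \<alpha>) t'" if "(\<alpha>, \<phi>) \<in> set (moves t)" for \<alpha> \<phi>
      using moves_inst_enabled Prefix.prems that by blast
  qed (use Prefix in blast)
  then show ?case using Prefix.prems(4) by (auto simp: moves_Prefix simp del: moves.simps)
next
  case (TVar X)
  then show ?case by (auto simp: closing_def)
next
  case (Choice t1 t2)
  from Choice.prems(4)
  consider "test_step (inst \<sigma> t1) (Lab \<alpha>) t'" | "test_step (inst \<sigma> t2) (Lab \<alpha>) t'" by auto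
  then show ?case
  proof cases
    case 1
    then show ?thesis using Choice.IH(1)[OF Choice.prems(1-3)] by fastforce
  next
    case 2
    then show ?thesis using Choice.IH(2)[OF Choice.prems(1-3)] by fastforce
  qed
next
  case (Mu X t)
  define \<sigma>' where "\<sigma>' = \<sigma>(X := inst \<sigma> (Mu X t))"
  define U' where "U' = U(X := inst \<sigma>' t)"
  \<comment> \<open>Shown below to be a pre-fixed point of the body, hence an upper bound of the
    least fixpoint.\<close>
  define Q where "Q = pass_set S T (inst \<sigma>' t)"
  have cl: "closing \<sigma>' U'"
    using closing_Mu[OF Mu.prems(2)] unfolding \<sigma>'_def U'_def by blast
  have \<alpha>: "\<alpha> = Tau" and t': "t' = inst \<sigma>' t"
    using Mu.prems(4) test_step_inst_Mu[OF Mu.prems(2)] unfolding \<sigma>'_def by blast+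
  have "sem S T (char_form t) (\<rho>(X := Q)) \<subseteq> pass_set S T (inst \<sigma>' t)"
    unfolding char_form_def
  proof (rule moves_form_sound)
    show "T \<subseteq> S \<times> UNIV \<times> S" by fact
    show "succeeds t \<longleftrightarrow> can_succeed (inst \<sigma>' t)"
      using succeeds_inst cl by blast
    show "\<exists>t'. test_step (inst \<sigma>' t) (Lab \<alpha>) t'" if "(\<alpha>, \<phi>) \<in> set (moves t)" for \<alpha> \<phi>
      using moves_inst_enabled cl that by blast
    have "(\<rho>(X := Q)) Y \<subseteq> pass_set S T (U' Y)" for Y
      using Mu.prems(3) by (simp add: Q_def U'_def)
    then show "\<exists>\<phi>. (\<alpha>, \<phi>) \<in> set (moves t) \<and> sem S T \<phi> (\<rho>(X := Q)) \<subseteq> pass_set S T t'"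
      if "test_step (inst \<sigma>' t) (Lab \<alpha>) t'" for \<alpha> t'
      using Mu.IH[OF Mu.prems(1) cl _ that] by blast
  qed
  then have "sem S T (MinF X (char_form t)) \<rho> \<subseteq> Q"
    unfolding sem.simps by (intro Inter_lower) (auto simp: Q_def pass_set_def)
  then show ?case using \<alpha> t' by (simp add: moves_Mu Q_def del: moves.simps sem.simps)
qed auto

section \<open>Completeness: passing implies satisfying the formula\<close>

text \<open>
  Completeness is proved by induction on passing. The set \<open>D\<close> collects experiments that are
  already known to be captured by the formulae standing for their residual tests. Experiments
  that have succeeded can still move, but such moves must not be followed by the induction;
  instead \<open>D\<close> contains all of them.
\<close>

definition residuals :: "'s set \<Rightarrow> ('s, 'a) trans \<Rightarrow> ('s \<times> 'a test) set \<Rightarrow> bool" where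
  "residuals S T D \<longleftrightarrow>
     (\<forall>(p, t)\<in>D. p \<in> S \<and> passes T (p, t)) \<and>
     (\<forall>e\<in>D. \<forall>e'. pending_step T e e' \<longrightarrow> e' \<in> D) \<and>
     (\<forall>p\<in>S. \<forall>t. can_succeed t \<longrightarrow> (p, t) \<in> D)"

lemma residuals_tau_star:
  assumes "T \<subseteq> S \<times> UNIV \<times> S" "residuals S T D" "(p, p') \<in> tau_star T" "(p, t) \<in> D"
  shows "(p', t) \<in> D"
  using assms(3) unfolding tau_star_def
proof (induction rule: rtrancl_induct)
  case base
  then show ?case using assms(4) by blast
next
  case (step q r)
  then have q: "(q, Tau, r) \<in> T" by simp
  then have "r \<in> S" using assms(1) by blast
  show ?case
  proof (cases "can_succeed t")
    case True
    then show ?thesis using \<open>r \<in> S\<close> assms(2) by (auto simp: residuals_def)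
  next
    case False
    then have "pending_step T (q, t) (r, t)"
      using q by (auto simp: pending_step_def intro: exp_step.left)
    then show ?thesis using step.IH assms(2) unfolding residuals_def by blast
  qed
qed

text \<open>Only the pending successors of \<open>(p, u)\<close> are required in \<open>D\<close>,
  not \<open>(p, u)\<close> itself. This lets recursion be treated with a \<open>D\<close> of later
  experiments.\<close>

lemma moves_form_complete:
  assumes T: "T \<subseteq> S \<times> UNIV \<times> S"
    and b: "b \<longleftrightarrow> can_succeed u"
    and D: "residuals S T D"
    and steps: "\<And>\<alpha> \<phi>. (\<alpha>, \<phi>) \<in> set L \<Longrightarrow>
      \<exists>t'. test_step u (Lab \<alpha>) t' \<and> {p. (p, t') \<in> D} \<subseteq> sem S T \<phi> \<rho>"
    and enabled: "\<And>\<alpha> t'. test_step u (Lab \<alpha>) t' \<Longrightarrow> \<exists>\<phi>. (\<alpha>, \<phi>) \<in> set L"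
    and p: "p \<in> S" "passes T (p, u)"
    and next_D: "\<And>e'. pending_step T (p, u) e' \<Longrightarrow> e' \<in> D"
  shows "p \<in> sem S T (moves_form b L) \<rho>"
proof (cases b)
  case True
  then show ?thesis using p by (simp add: moves_form_def)
next
  case False
  then have nsucc: "\<not> can_succeed u" using b by simp
  have conv: "converges T p" by (rule passes_converges[OF p(2) nsucc])
  \<comment> \<open>While the process makes \<tau>-moves the test stays at \<open>u\<close>, which
    cannot succeed, so all steps on the path are pending.\<close>
  have weak_D: "e' \<in> D" if "(p, q) \<in> tau_star T" "exp_step T (q, u) e'" for q e'
  proof -
    have "\<forall>e'. pending_step T (q, u) e' \<longrightarrow> e' \<in> D"
      using that(1) unfolding tau_star_def
    proof (induction rule: rtrancl_induct)
      case base
      then show ?case using next_D by blast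
    next
      case (step q r)
      then have "pending_step T (q, u) (r, u)"
        using nsucc by (auto simp: pending_step_def intro: exp_step.left)
      then show ?case using step.IH D unfolding residuals_def by blast
    qed
    then show ?thesis using that(2) nsucc unfolding pending_step_def snd_conv by blast
  qed
  have box: "p \<in> sem S T (Box \<alpha> \<phi>) \<rho>" if in_L: "(\<alpha>, \<phi>) \<in> set L" for \<alpha> \<phi>
  proof -
    obtain t' where t': "test_step u (Lab \<alpha>) t'" "{p. (p, t') \<in> D} \<subseteq> sem S T \<phi> \<rho>"
      using steps in_L by blast
    have "(p', t') \<in> D" if "weak T \<alpha> p p'" for p'
    proof (cases \<alpha>)
      case Tau
      then show ?thesis using that t'(1) weak_D exp_step.right by fastforce
    next
      case (Vis a)
      then obtain q r where "(p, q) \<in> tau_star T" "(q, Vis a, r) \<in> T" "(r, p') \<in> tau_star T"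
        using \<open>weak T \<alpha> p p'\<close> by auto
      then show ?thesis
        using t'(1) Vis weak_D exp_step.comm residuals_tau_star[OF T D] by metis
    qed
    then show ?thesis using p(1) conv t'(2) by auto
  qed
  have "p \<in> sem S T (Acc (fset_of_list [a. (Vis a, _) \<leftarrow> L])) \<rho>" if "Tau \<notin> fst ` set L"
  proof -
    have "\<exists>a s. a |\<in>| fset_of_list [a. (Vis a, _) \<leftarrow> L] \<and> weak T (Vis a) p' s"
      if p': "weak T Tau p p'" for p'
    proof -
      have "passes T (p', u)" using p' p(2) nsucc passes_tau_star by fastforce
      moreover have "\<not> test_step u (Lab Tau) t'" for t'
        using enabled \<open>Tau \<notin> fst ` set L\<close> by force
      ultimately obtain a t' s where a: "test_step u (Lab (Vis a)) t'" "weak T (Vis a) p' s"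
        using passes_weak_action[of T p' u] nsucc by blast
      then obtain \<phi> where "(Vis a, \<phi>) \<in> set L" using enabled by blast
      then have "a |\<in>| fset_of_list [a. (Vis a, _) \<leftarrow> L]"
        by (force simp: fset_of_list_elem)
      then show ?thesis using a(2) by blast
    qed
    then show ?thesis using p(1) conv by auto
  qed
  then show ?thesis
    using False p(1) box by (auto simp: moves_form_def sem_conj_list simp del: sem.simps)
qed

lemma moves_inst_exhaustive:
  assumes "closing \<sigma> U" "test_step (inst \<sigma> t) (Lab \<alpha>) t'"
  shows "\<exists>\<phi>. (\<alpha>, \<phi>) \<in> set (moves t)"
  using assms
proof (induction t)
  case (Choice t1 t2)
  then show ?case by fastforce
qed (auto simp: closing_def)

text \<open>For recursion, \<open>D\<close> shrinks to what is reached from \<open>e\<close> in at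
  least one pending step, where the induction hypothesis on passing is available. Experiments able
  to succeed are put back, as \<open>residuals\<close> demands.\<close>

lemma residuals_after:
  assumes D: "residuals S T D" and e: "e \<in> D"
  defines "D' \<equiv> {e'. (pending_step T)\<^sup>+\<^sup>+ e e'} \<union> {(p, t). p \<in> S \<and> can_succeed t}"
  shows "residuals S T D'" "D' \<subseteq> D"
proof -
  have "e' \<in> D" if "(pending_step T)\<^sup>+\<^sup>+ e e'" for e'
    using that by (induction rule: tranclp_induct) (use D e in \<open>auto simp: residuals_def\<close>)
  moreover have "(p, t) \<in> D" if "p \<in> S" "can_succeed t" for p t
    using that D unfolding residuals_def by blast
  ultimately show sub: "D' \<subseteq> D" unfolding D'_def by blast
  have "e2 \<in> D'" if "e1 \<in> D'" "pending_step T e1 e2" for e1 e2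
    using that by (auto simp: D'_def pending_step_def dest: tranclp.trancl_into_trancl)
  then show "residuals S T D'"
    using D sub unfolding residuals_def by (auto simp: D'_def intro: passes_can_succeed)
qed

lemma moves_complete:
  assumes "T \<subseteq> S \<times> UNIV \<times> S" "closing \<sigma> U" "residuals S T D"
    and "\<And>X. {p. (p, U X) \<in> D} \<subseteq> \<rho> X" "(\<alpha>, \<phi>) \<in> set (moves t)"
  shows "\<exists>t'. test_step (inst \<sigma> t) (Lab \<alpha>) t' \<and> {p. (p, t') \<in> D} \<subseteq> sem S T \<phi> \<rho>"
  using assms
proof (induction t arbitrary: \<sigma> U D \<rho> \<alpha> \<phi>)
  case (Prefix \<beta> t)
  have "p \<in> sem S T (char_form t) \<rho>" if p: "(p, inst \<sigma> t) \<in> D" for p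
    unfolding char_form_def
  proof (rule moves_form_complete)
    show "T \<subseteq> S \<times> UNIV \<times> S" "residuals S T D" by fact+
    show "succeeds t \<longleftrightarrow> can_succeed (inst \<sigma> t)"
      using succeeds_inst Prefix.prems(2) by blast
    show "\<exists>\<phi>. (\<alpha>, \<phi>) \<in> set (moves t)" if "test_step (inst \<sigma> t) (Lab \<alpha>) t'" for \<alpha> t'
      using moves_inst_exhaustive Prefix.prems(2) that by blast
    show "p \<in> S" "passes T (p, inst \<sigma> t)"
      using p Prefix.prems(3) unfolding residuals_def by blast+
    show "e' \<in> D" if "pending_step T (p, inst \<sigma> t) e'" for e'
      using that p Prefix.prems(3) unfolding residuals_def by blast
  qed (use Prefix.IH[OF Prefix.prems(1-4)] in blast)
  then show ?case using Prefix.prems(5) by (auto simp: moves_Prefix simp del: moves.simps)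
next
  case (TVar X)
  then show ?case by (auto simp: closing_def)
next
  case (Choice t1 t2)
  from Choice.prems(5)
  consider "(\<alpha>, \<phi>) \<in> set (moves t1)" | "(\<alpha>, \<phi>) \<in> set (moves t2)" by auto
  then show ?case
  proof cases
    case 1
    then show ?thesis using Choice.IH(1)[OF Choice.prems(1-4)] by fastforce
  next
    case 2
    then show ?thesis using Choice.IH(2)[OF Choice.prems(1-4)] by fastforce
  qed
next
  case (Mu X t)
  define \<sigma>' where "\<sigma>' = \<sigma>(X := inst \<sigma> (Mu X t))"
  define U' where "U' = U(X := inst \<sigma>' t)"
  have cl: "closing \<sigma>' U'"
    using closing_Mu[OF Mu.prems(2)] unfolding \<sigma>'_def U'_def by blast
  have succeeds: "succeeds t \<longleftrightarrow> can_succeed (inst \<sigma>' t)"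
    using succeeds_inst cl by blast
  have \<alpha>: "\<alpha> = Tau" and \<phi>: "\<phi> = MinF X (char_form t)"
    using Mu.prems(5) by (simp_all add: moves_Mu del: moves.simps)
  \<comment> \<open>\<open>P\<close> is an arbitrary pre-fixed point of the body; membership follows
    by an inner induction on passing, with the structural hypothesis applied to a smaller
    \<open>D'\<close>.\<close>
  have "p \<in> P"
    if P: "P \<subseteq> S" "sem S T (char_form t) (\<rho>(X := P)) \<subseteq> P" and p: "(p, inst \<sigma>' t) \<in> D" for P p
  proof -
    have "\<And>p. e = (p, inst \<sigma>' t) \<Longrightarrow> e \<in> D \<Longrightarrow> p \<in> P" if "passes T e" for e
      using that
    proof (induction rule: passes_strong_induct)
      case (less e)
      define D' where "D' = {e'. (pending_step T)\<^sup>+\<^sup>+ e e'} \<union> {(p, t). p \<in> S \<and> can_succeed t}"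
      have D': "residuals S T D'" "D' \<subseteq> D"
        unfolding D'_def using residuals_after[OF Mu.prems(3) less.prems(2)] by blast+
      \<comment> \<open>Either the inner hypothesis applies, or the unfolding succeeds at once; then
        the body has the formula \<open>TT\<close>, so \<open>S \<subseteq> P\<close>.\<close>
      have X: "q \<in> P" if q: "(q, inst \<sigma>' t) \<in> D'" for q
      proof (cases "(pending_step T)\<^sup>+\<^sup>+ e (q, inst \<sigma>' t)")
        case True
        then show ?thesis using less.IH q D'(2) by blast
      next
        case False
        then have "q \<in> S" "succeeds t" using q succeeds by (auto simp: D'_def)
        then show ?thesis using P(2) by (auto simp: char_form_def moves_form_def)
      qed
      have env: "{p. (p, U' Y) \<in> D'} \<subseteq> (\<rho>(X := P)) Y" for Y
        using X Mu.prems(4)[of Y] D'(2) by (auto simp: U'_def)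
      have "p \<in> sem S T (char_form t) (\<rho>(X := P))"
        unfolding char_form_def
      proof (rule moves_form_complete)
        show "T \<subseteq> S \<times> UNIV \<times> S" "residuals S T D'" by fact+
        show "succeeds t \<longleftrightarrow> can_succeed (inst \<sigma>' t)" by fact
        show "\<exists>\<phi>. (\<alpha>, \<phi>) \<in> set (moves t)" if "test_step (inst \<sigma>' t) (Lab \<alpha>) t'" for \<alpha> t'
          using moves_inst_exhaustive cl that by blast
        show "p \<in> S" using less.prems Mu.prems(3) unfolding residuals_def by blast
        show "passes T (p, inst \<sigma>' t)" using less by simp
        show "e' \<in> D'" if "pending_step T (p, inst \<sigma>' t) e'" for e'
          using that less.prems(1) by (auto simp: D'_def)
      qed (rule Mu.IH[OF Mu.prems(1) cl D'(1) env])
      then show ?case using P(2) by blast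
    qed
    moreover have "passes T (p, inst \<sigma>' t)" using p Mu.prems(3) unfolding residuals_def by blast
    ultimately show ?thesis using p by blast
  qed
  then have "{p. (p, inst \<sigma>' t) \<in> D} \<subseteq> sem S T \<phi> \<rho>" unfolding \<phi> by auto
  then show ?case
    using \<alpha> test_step_inst_Mu[OF Mu.prems(2)] unfolding \<sigma>'_def by blast
qed auto

section \<open>Closed tests and the conclusion\<close>

lemma csem_char_form:
  assumes T: "T \<subseteq> S \<times> UNIV \<times> S" and t: "test_fv t = {}"
  shows "csem S T (char_form t) = pass_set S T t"
proof
  let ?\<sigma> = "\<lambda>X. Mu X Stop" and ?U = "\<lambda>X. Stop"
  have inst: "inst ?\<sigma> t = t" using t by (rule inst_closed)
  have succeeds: "succeeds t \<longleftrightarrow> can_succeed t"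
    using succeeds_inst[OF closing_Mu_Stop, of t] inst by simp
  show "csem S T (char_form t) \<subseteq> pass_set S T t"
    unfolding csem_def char_form_def
  proof (rule moves_form_sound[OF T succeeds])
    show "\<exists>\<phi>. (\<alpha>, \<phi>) \<in> set (moves t) \<and> sem S T \<phi> (\<lambda>_. {}) \<subseteq> pass_set S T t'"
      if "test_step t (Lab \<alpha>) t'" for \<alpha> t'
      using moves_sound[OF T closing_Mu_Stop, of "\<lambda>_. {}" t] that inst by simp
    show "\<exists>t'. test_step t (Lab \<alpha>) t'" if "(\<alpha>, \<phi>) \<in> set (moves t)" for \<alpha> \<phi>
      using moves_inst_enabled[OF closing_Mu_Stop that] inst by simp
  qed
  define D where "D = {(p, t). p \<in> S \<and> passes T (p, t)}"
  have T': "p' \<in> S" if "exp_step T (p, s) (p', s')" "p \<in> S" for p s p' s'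
    using that T by (auto elim: exp_step.cases)
  have D: "residuals S T D"
    using T' by (auto simp: residuals_def D_def pending_step_def intro: passes_step passes_can_succeed)
  \<comment> \<open>\<open>Stop\<close> never moves, so its experiments deadlock or run forever
    without success. The empty environment is therefore large enough.\<close>
  have "\<not> passes T (p, Stop)" for p
  proof
    have "snd e = Stop \<Longrightarrow> False" if "passes T e" for e
      using that
    proof (induction rule: passes.induct)
      case (later e d)
      from later.hyps(1) later.prems have "snd d = Stop" by (auto elim: exp_step.cases)
      then show ?case using later by blast
    qed simp
    then show "passes T (p, Stop) \<Longrightarrow> False" by fastforce
  qed
  then have env: "{p. (p, Stop) \<in> D} \<subseteq> {}" by (simp add: D_def)
  show "pass_set S T t \<subseteq> csem S T (char_form t)"
    unfolding csem_def char_form_def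
  proof
    fix p assume "p \<in> pass_set S T t"
    then have p: "p \<in> S" "passes T (p, t)" "(p, t) \<in> D" by (auto simp: pass_set_def D_def)
    show "p \<in> sem S T (moves_form (succeeds t) (moves t)) (\<lambda>_. {})"
    proof (rule moves_form_complete[OF T succeeds D])
      show "\<exists>t'. test_step t (Lab \<alpha>) t' \<and> {p. (p, t') \<in> D} \<subseteq> sem S T \<phi> (\<lambda>_. {})"
        if "(\<alpha>, \<phi>) \<in> set (moves t)" for \<alpha> \<phi>
        using moves_complete[OF T closing_Mu_Stop D env that] inst by simp
      show "\<exists>\<phi>. (\<alpha>, \<phi>) \<in> set (moves t)" if "test_step t (Lab \<alpha>) t'" for \<alpha> t'
        using moves_inst_exhaustive[OF closing_Mu_Stop, of t] that inst by simp
      show "e' \<in> D" if "pending_step T (p, t) e'" for e'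
        using that p(3) D unfolding residuals_def by blast
    qed fact+
  qed
qed

text \<open>Testability constrains a formula only on \<open>S\<close>; this excludes elements
  outside. For \<open>MinF\<close>, the set \<open>S\<close> is itself a pre-fixed point, so the
  intersection is not over an empty family.\<close>

lemma sem_subset: "(\<And>X. \<rho> X \<subseteq> S) \<Longrightarrow> sem S T \<phi> \<rho> \<subseteq> S"
proof (induction \<phi> arbitrary: \<rho>)
  case (MinF X \<phi>)
  have "sem S T \<phi> (\<rho>(X := S)) \<subseteq> S"
    by (rule MinF.IH) (use MinF.prems in auto)
  then show ?case by auto
qed auto

theorem corollary4p19:
  fixes Act :: "'a set" and S :: "'s set" and T :: "('s, 'a) trans" and \<phi> :: "'a form"
  assumes "lts Act S T"
    and "finite_branching S T"
    and "\<phi> \<in> recHML Act"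
    and "must_testable Act S T \<phi>"
  shows "\<exists>\<psi> \<in> mustHML Act. csem S T \<psi> = csem S T \<phi>"
proof -
  have T: "T \<subseteq> S \<times> UNIV \<times> S" using assms(1) by (auto simp: lts_def)
  from assms(4) obtain t where t: "t \<in> tests Act"
    and \<phi>: "\<And>p. p \<in> S \<Longrightarrow> must_satisfy T p t \<longleftrightarrow> p \<in> csem S T \<phi>"
    unfolding must_testable_def by blast
  have "csem S T (char_form t) = pass_set S T t"
    using csem_char_form[OF T] t by (simp add: tests_def)
  also have "\<dots> = csem S T \<phi>"
    using \<phi> sem_subset[of "\<lambda>_. {}" S T \<phi>]
    by (auto simp: pass_set_def csem_def must_satisfy_iff_passes)
  finally show ?thesis using char_form_mustHML[OF t] by blast
qed

end
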